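(* $\mathcal{P}_\iota^{*\infty}=\emptyset$. (That is, there is no informationally infinitely divisible discrete random variable.)
   Context: For a discrete random variable $X$ with pmf $p_X$, the self information is $\iota_X(x):=-\log p_X(x)$ ($\log$ to base $2$), and its information spectrum cdf is $F_{\iota_X}(t):=\mathbf{P}(\iota_X(X)\le t)$. Let $\mathcal{P}_\iota:=\{F_{\iota_X}: X\text{ is a discrete random variable}\}$. The convolution $F_1*F_2$ of cdf's is the cdf of the sum of independent random variables with cdf's $F_1,F_2$; $F^{*n}$ is the $n$-fold convolution of $F$ with itself. Define $\mathcal{P}_\iota^{*n}:=\{F^{*n}:F\in\mathcal{P}_\iota\}$ for $n\in\mathbb{N}=\{1,2,\ldots\}$ and $\mathcal{P}_\iota^{*\infty}:=\bigcap_{n\in\mathbb{N}}\mathcal{P}_\iota^{*n}$. A discrete random variable $X$ is called informationally infinitely divisible if, for any $n\ge1$, there exist i.i.d. random variables $Z_1,\ldots,Z_n$ and an injective function $f$ such that $X=f(Z_1,\ldots,Z_n)$; this holds if and only if $F_{\iota_X}\in\mathcal{P}_\iota^{*\infty}$.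
   Formalization: Constant random variables are excluded: their information spectrum, the unit step at 0, equals all its own convolution powers and so lies in the intersection; what is shown is that the intersection contains nothing else and no non-constant X is informationally infinitely divisible. *)

theory Defs
  imports "HOL-Probability.Probability"
begin

text \<open>
  A discrete random variable enters only through its distribution, an \<open>'a pmf\<close>.
  Off the support (a null set) \<open>self_info\<close> takes the irrelevant value \<open>0\<close>.
\<close>

definition self_info :: "'a pmf \<Rightarrow> 'a \<Rightarrow> real" where
  "self_info p x = - log 2 (pmf p x)"

definition info_cdf :: "'a pmf \<Rightarrow> real \<Rightarrow> real" where
  "info_cdf p t = measure_pmf.prob p {x. self_info p x \<le> t}"

text \<open>
  Every discrete distribution has countable support, so distributions on \<open>nat\<close> already
  produce all information spectra; see \<open>info_cdf_in_info_spectra\<close> below.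
\<close>

definition info_spectra :: "(real \<Rightarrow> real) set" where
  "info_spectra = range (info_cdf :: nat pmf \<Rightarrow> real \<Rightarrow> real)"

text \<open>
  For a cdf \<open>F\<close>, \<open>interval_measure F\<close> is the distribution with cdf \<open>F\<close>, and \<open>\<star>\<close> is the
  distribution of the sum of independent variables.
\<close>

definition cdf_conv :: "(real \<Rightarrow> real) \<Rightarrow> (real \<Rightarrow> real) \<Rightarrow> real \<Rightarrow> real" where
  "cdf_conv F G = cdf (interval_measure F \<star> interval_measure G)"

text \<open>Only exponents \<open>n \<ge> 1\<close> are meaningful: \<open>n - 1\<close> convolutions of \<open>n\<close> copies of \<open>F\<close>.\<close>

definition cdf_conv_power :: "(real \<Rightarrow> real) \<Rightarrow> nat \<Rightarrow> real \<Rightarrow> real" where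
  "cdf_conv_power F n = (cdf_conv F ^^ (n - 1)) F"

definition info_spectra_power :: "nat \<Rightarrow> (real \<Rightarrow> real) set" where
  "info_spectra_power n = (\<lambda>F. cdf_conv_power F n) ` info_spectra"

definition info_spectra_inf :: "(real \<Rightarrow> real) set" where
  "info_spectra_inf = (\<Inter>n\<in>{1..}. info_spectra_power n)"

text \<open>
  \<open>X = f (Z\<^sub>1, \<dots>, Z\<^sub>n)\<close> is read in distribution (the \<open>Z\<^sub>i\<close> may live on another probability
  space) and \<open>f\<close> need only be injective on the values that \<open>(Z\<^sub>1, \<dots>, Z\<^sub>n)\<close> attains.
  The alphabet of the \<open>Z\<^sub>i\<close> can be taken to be \<open>nat\<close>; see \<open>info_infinitely_divisibleI\<close>.
\<close>

definition info_infinitely_divisible :: "'a pmf \<Rightarrow> bool" where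
  "info_infinitely_divisible p \<longleftrightarrow>
     (\<forall>n\<ge>1. \<exists>(q :: nat pmf) (f :: nat list \<Rightarrow> 'a).
        inj_on f (set_pmf (replicate_pmf n q)) \<and> p = map_pmf f (replicate_pmf n q))"


lemma info_cdf_map_inj:
  assumes "inj_on f (set_pmf p)"
  shows "info_cdf (map_pmf f p) = info_cdf p"
proof
  fix t
  have "info_cdf (map_pmf f p) t = measure_pmf.prob p {x. self_info (map_pmf f p) (f x) \<le> t}"
    by (simp add: info_cdf_def vimage_def)
  also have "\<dots> = info_cdf p t"
    unfolding info_cdf_def
    by (rule measure_pmf.finite_measure_eq_AE)
       (auto simp: AE_measure_pmf_iff self_info_def pmf_map_inj assms)
  finally show "info_cdf (map_pmf f p) t = info_cdf p t" .
qed

lemma info_cdf_in_info_spectra: "info_cdf (p :: 'a pmf) \<in> info_spectra"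
proof -
  have "info_cdf p = info_cdf (map_pmf (to_nat_on (set_pmf p)) p)"
    by (rule info_cdf_map_inj [symmetric]) (simp add: inj_on_to_nat_on)
  then show ?thesis
    by (simp add: info_spectra_def)
qed

lemma info_cdf_eq_cdf: "info_cdf p = cdf (distr (measure_pmf p) borel (self_info p))"
  by (rule ext) (simp add: info_cdf_def cdf_def measure_distr vimage_def)

lemma interval_measure_cdf:
  assumes "real_distribution M"
  shows "interval_measure (cdf M) = M"
proof -
  interpret real_distribution M by fact
  have "real_distribution (interval_measure (cdf M))"
    by (rule real_distribution_interval_measure)
       (use cdf_nondecreasing cdf_is_right_cont cdf_lim_at_bot cdf_lim_at_top_prob in auto)
  moreover have "cdf (interval_measure (cdf M)) = cdf M"
    by (rule cdf_interval_measure)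
       (use cdf_nondecreasing cdf_is_right_cont cdf_lim_at_bot in auto)
  ultimately show ?thesis
    using assms by (intro cdf_unique)
qed

lemma (in prob_space) cdf_conv_indep_var:
  fixes X Y :: "'a \<Rightarrow> real"
  assumes "indep_var borel X borel Y"
  shows "cdf_conv (cdf (distr M borel X)) (cdf (distr M borel Y)) =
         cdf (distr M borel (\<lambda>\<omega>. X \<omega> + Y \<omega>))"
proof -
  have [measurable]: "random_variable borel X" "random_variable borel Y"
    using assms by (auto dest: indep_var_rv1 indep_var_rv2)
  show ?thesis
    using sum_indep_random_variable [OF assms]
    by (simp add: cdf_conv_def interval_measure_cdf)
qed

text \<open>The information spectrum of a constant (carrying no information) is a trivial member.\<close>

lemma info_cdf_return_in_info_spectra_inf: "info_cdf (return_pmf x) \<in> info_spectra_inf"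
proof -
  let ?F = "info_cdf (return_pmf x)"
  have F: "?F = cdf (distr (measure_pmf (return_pmf x)) borel (\<lambda>_. 0))"
  proof
    fix t
    show "?F t = cdf (distr (measure_pmf (return_pmf x)) borel (\<lambda>_. 0)) t"
      by (simp add: info_cdf_def self_info_def cdf_def measure_return indicator_def)
  qed
  have "cdf_conv ?F ?F = ?F"
  proof -
    have "prob_space.indep_var (measure_pmf (return_pmf x)) borel (\<lambda>_. 0 :: real) borel (\<lambda>_. 0 :: real)"
      by (auto simp: prob_space.indep_var_eq [OF prob_space_measure_pmf]
          prob_space.indep_sets2_eq [OF prob_space_measure_pmf] indicator_def)
    from prob_space.cdf_conv_indep_var [OF prob_space_measure_pmf this] show ?thesis
      by (simp add: F)
  qed
  then have "(cdf_conv ?F ^^ k) ?F = ?F" for k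
    by (induction k) auto
  then show ?thesis
    unfolding info_spectra_inf_def info_spectra_power_def cdf_conv_power_def
    by (auto intro!: image_eqI [OF _ info_cdf_in_info_spectra [of "return_pmf x"]])
qed

lemma map_replicate_pmf: "replicate_pmf n (map_pmf g q) = map_pmf (map g) (replicate_pmf n q)"
  by (induction n) (simp_all add: map_pmf_def bind_assoc_pmf bind_return_pmf)

lemma info_infinitely_divisibleI:
  assumes "\<And>n. n \<ge> 1 \<Longrightarrow> \<exists>(q :: 'b pmf) (f :: 'b list \<Rightarrow> 'a).
    inj_on f (set_pmf (replicate_pmf n q)) \<and> p = map_pmf f (replicate_pmf n q)"
  shows "info_infinitely_divisible p"
  unfolding info_infinitely_divisible_def
proof (intro allI impI)
  fix n :: nat
  assume "n \<ge> 1"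
  then obtain q :: "'b pmf" and f :: "'b list \<Rightarrow> 'a"
    where f: "inj_on f (set_pmf (replicate_pmf n q))" and p: "p = map_pmf f (replicate_pmf n q)"
    using assms by blast
  let ?g = "to_nat_on (set_pmf q)"
  let ?h = "from_nat_into (set_pmf q)"
  have inv: "map ?h (map ?g zs) = zs" if "zs \<in> set_pmf (replicate_pmf n q)" for zs
    using that by (auto simp: set_replicate_pmf intro!: map_idI)
  have rep: "replicate_pmf n (map_pmf ?g q) = map_pmf (map ?g) (replicate_pmf n q)"
    by (rule map_replicate_pmf)
  have "inj_on (f \<circ> map ?h) (set_pmf (replicate_pmf n (map_pmf ?g q)))"
    unfolding rep using f inv by (auto simp: inj_on_def simp del: map_map)
  moreover have "map_pmf (f \<circ> map ?h) (replicate_pmf n (map_pmf ?g q)) = p"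
    unfolding rep p pmf.map_comp using inv
    by (intro map_pmf_cong) (auto simp del: map_map)
  ultimately show "\<exists>(q :: nat pmf) (f :: nat list \<Rightarrow> 'a).
      inj_on f (set_pmf (replicate_pmf n q)) \<and> p = map_pmf f (replicate_pmf n q)"
    by metis
qed

end

theory Submission
  imports Defs
begin

text \<open>
  Let \<open>q\<close> be a distribution with mode \<open>a\<close>. A word \<open>v\<close> of length \<open>n\<close> other than \<open>a\<^sup>n\<close> gives rise
  to \<open>n\<close> different words that are at least as likely under \<open>q\<^sup>n\<close>, so \<open>v\<close> has probability at most
  \<open>1 / n\<close>. Suppose \<open>q\<^sup>n\<close> has the information spectrum of a non-degenerate \<open>p\<close>, let \<open>x\<close> be a mode
  of \<open>p\<close> and \<open>y \<noteq> x\<close> in its support, and put \<open>c = p y\<close>. Then \<open>q\<^sup>n\<close> gives the words of probability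
  at least \<open>c\<close> a total mass of at least \<open>p x + c\<close>, while no single word has a probability that
  large. Hence some word other than \<open>a\<^sup>n\<close> has probability at least \<open>c\<close>, and \<open>n \<le> 1 / c\<close>.
\<close>

section \<open>Atoms, modes and words of independent letters\<close>

lemma card_mult_le_one_if_pmf_ge:
  assumes "finite A" and "\<And>x. x \<in> A \<Longrightarrow> c \<le> pmf p x"
  shows "real (card A) * c \<le> 1"
proof -
  have "real (card A) * c = (\<Sum>x\<in>A. c)"
    by simp
  also have "\<dots> \<le> (\<Sum>x\<in>A. pmf p x)"
    using assms(2) by (rule sum_mono)
  also have "\<dots> = measure_pmf.prob p A"
    using assms(1) by (simp add: measure_measure_pmf_finite)
  also have "\<dots> \<le> 1"
    by simp
  finally show ?thesis .
qed

lemma finite_pmf_ge: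
  assumes "c > 0"
  shows "finite {x. c \<le> pmf p x}"
proof (rule ccontr)
  obtain n :: nat where n: "1 < real n * c"
    using assms reals_Archimedean3 by blast
  assume "infinite {x. c \<le> pmf p x}"
  then obtain A where "A \<subseteq> {x. c \<le> pmf p x}" "finite A" "card A = n"
    by (meson infinite_arbitrarily_large)
  then have "real n * c \<le> 1"
    using card_mult_le_one_if_pmf_ge [of A c p] by auto
  with n show False
    by simp
qed

lemma pmf_has_mode:
  obtains a where "\<And>x. pmf p x \<le> pmf p a"
proof -
  obtain x0 where x0: "x0 \<in> set_pmf p"
    using set_pmf_not_empty by fast
  \<comment> \<open>Only atoms at least as likely as \<open>x0\<close> compete for the maximum. They
    are finitely many, so it is attained even when the support is infinite.\<close>
  define S where "S = {x. pmf p x0 \<le> pmf p x}"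
  have "finite S"
    unfolding S_def using x0 by (intro finite_pmf_ge) (simp add: pmf_positive)
  moreover have "x0 \<in> S"
    by (simp add: S_def)
  ultimately have "Max (pmf p ` S) \<in> pmf p ` S" and le: "\<And>x. x \<in> S \<Longrightarrow> pmf p x \<le> Max (pmf p ` S)"
    by (auto intro!: Max_in Max_ge)
  then obtain a where a: "a \<in> S" "Max (pmf p ` S) = pmf p a"
    by blast
  have "pmf p x \<le> pmf p a" for x
    using a le [of x] le [OF \<open>x0 \<in> S\<close>] by (cases "x \<in> S") (simp_all add: S_def)
  then show thesis
    by (rule that)
qed

text \<open>Presents the recursion as an injective image of a product, so that
  \<open>pmf_map_inj'\<close> and \<open>info_cdf_map_inj\<close> apply.\<close>

lemma replicate_pmf_Suc_pair:
  "replicate_pmf (Suc n) q = map_pmf (\<lambda>(x, xs). x # xs) (pair_pmf q (replicate_pmf n q))"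
  by (simp add: pair_pmf_def map_bind_pmf bind_return_pmf)

lemma pmf_replicate_pmf:
  "pmf (replicate_pmf n q) xs = (if length xs = n then prod_list (map (pmf q) xs) else 0)"
proof (induction n arbitrary: xs)
  case 0
  then show ?case
    by (auto simp: pmf_return)
next
  case (Suc n)
  show ?case
  proof (cases xs)
    case Nil
    then show ?thesis
      unfolding replicate_pmf_Suc_pair by (auto simp: pmf_eq_0_set_pmf)
  next
    case (Cons y ys)
    have "pmf (replicate_pmf (Suc n) q) ((\<lambda>(x, xs). x # xs) (y, ys)) = pmf (pair_pmf q (replicate_pmf n q)) (y, ys)"
      unfolding replicate_pmf_Suc_pair by (rule pmf_map_inj') (auto simp: inj_on_def)
    then show ?thesis
      using Suc Cons by (auto simp: pmf_pair)
  qed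
qed

lemma pmf_replicate_pmf_le_of_not_mode:
  assumes mode: "\<And>x. pmf q x \<le> pmf q a"
    and len: "length v = n" and v: "v \<noteq> replicate n a"
  shows "real n * pmf (replicate_pmf n q) v \<le> 1"
proof -
  obtain j where j: "j < n" "v ! j \<noteq> a"
    using len v by (metis length_replicate nth_equalityI nth_replicate)
  \<comment> \<open>Raising a letter to the mode \<open>a\<close> increases the probability; where the letter is already
    \<open>a\<close>, swap it with the fixed letter \<open>v ! j \<noteq> a\<close> instead.\<close>
  define g where "g i = (if v ! i = a then v[j := v ! i, i := v ! j] else v[i := a])" for i
  \<comment> \<open>Exactly one of \<open>v ! i\<close> and \<open>g i ! i\<close> is
    \<open>a\<close>. For \<open>k \<noteq> i\<close>, the word \<open>g k\<close> differs from
    \<open>v\<close> at \<open>i\<close> only if \<open>i = j\<close> and \<open>v ! k = a\<close>;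
    then position \<open>k\<close> separates the two words, since only \<open>g k\<close> alters
    it.\<close>
  have inj: "inj_on g {..<n}"
  proof (rule inj_onI)
    fix i k assume ik: "i \<in> {..<n}" "k \<in> {..<n}" "g i = g k"
    then have "i < n" "k < n" "g i ! i = g k ! i" "g i ! k = g k ! k"
      by simp_all
    then show "i = k"
      using j len by (auto simp: g_def nth_list_update split: if_splits)
  qed
  have "pmf (replicate_pmf n q) v \<le> pmf (replicate_pmf n q) (g i)" if "i < n" for i
  proof (cases "v ! i = a")
    case True
    then have "mset (g i) = mset v"
      using that j len by (auto simp: g_def intro!: mset_swap)
    then have "mset (map (pmf q) (g i)) = mset (map (pmf q) v)"
      by simp
    then have "prod_list (map (pmf q) (g i)) = prod_list (map (pmf q) v)"
      by (metis prod_mset_prod_list)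
    then show ?thesis
      using len by (simp add: pmf_replicate_pmf g_def)
  next
    case False
    have "prod_list (map (pmf q) v) \<le> prod_list (map (pmf q) (g i))"
      using False len mode that
      by (auto simp: prod.list_conv_set_nth g_def nth_list_update intro!: prod_mono)
    then show ?thesis
      using len by (simp add: pmf_replicate_pmf g_def)
  qed
  then have "real (card (g ` {..<n})) * pmf (replicate_pmf n q) v \<le> 1"
    by (intro card_mult_le_one_if_pmf_ge [of _ _ "replicate_pmf n q"]) auto
  then show ?thesis
    by (simp add: card_image inj)
qed

section \<open>Convolution of spectra\<close>

text \<open>The coordinates of \<open>pair_pmf\<close> serve as the independent variables, so
  convolving spectra stays among pmfs.\<close>

lemma convolution_distr_pmf:
  "distr (measure_pmf p) borel f \<star> distr (measure_pmf q) borel g =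
   distr (measure_pmf (pair_pmf p q)) borel (\<lambda>(x, y). f x + g y :: real)"
proof (rule measure_eqI)
  show "sets (distr (measure_pmf p) borel f \<star> distr (measure_pmf q) borel g) =
    sets (distr (measure_pmf (pair_pmf p q)) borel (\<lambda>(x, y). f x + g y))"
    by simp
next
  fix A assume "A \<in> sets (distr (measure_pmf p) borel f \<star> distr (measure_pmf q) borel g)"
  then have A[measurable]: "A \<in> sets borel"
    by simp
  interpret P: prob_space "distr (measure_pmf p) borel f"
    by (rule measure_pmf.prob_space_distr) simp
  interpret Q: prob_space "distr (measure_pmf q) borel g"
    by (rule measure_pmf.prob_space_distr) simp
  have "emeasure (distr (measure_pmf p) borel f \<star> distr (measure_pmf q) borel g) A =
      (\<integral>\<^sup>+x. \<integral>\<^sup>+y. indicator A (x + y) \<partial>distr (measure_pmf q) borel g \<partial>distr (measure_pmf p) borel f)"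
    using P.finite_measure_axioms Q.finite_measure_axioms
    by (subst nn_integral_indicator [symmetric], simp)
       (subst nn_integral_convolution, auto)
  also have "\<dots> = (\<integral>\<^sup>+x. \<integral>\<^sup>+y. indicator A (f x + y) \<partial>distr (measure_pmf q) borel g \<partial>measure_pmf p)"
    by (rule nn_integral_distr) (simp, measurable)
  also have "\<dots> = (\<integral>\<^sup>+x. \<integral>\<^sup>+y. indicator A (f x + g y) \<partial>measure_pmf q \<partial>measure_pmf p)"
    by (intro nn_integral_cong nn_integral_distr) simp_all
  also have "\<dots> = (\<integral>\<^sup>+z. indicator A (case z of (x, y) \<Rightarrow> f x + g y) \<partial>measure_pmf (pair_pmf p q))"
    by (simp add: nn_integral_pair_pmf')
  also have "\<dots> = emeasure (distr (measure_pmf (pair_pmf p q)) borel (\<lambda>(x, y). f x + g y)) A"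
    by (subst nn_integral_distr [symmetric, where M' = borel and f = "indicator A"]) simp_all
  finally show "emeasure (distr (measure_pmf p) borel f \<star> distr (measure_pmf q) borel g) A =
    emeasure (distr (measure_pmf (pair_pmf p q)) borel (\<lambda>(x, y). f x + g y)) A" .
qed

lemma real_distribution_self_info:
  "real_distribution (distr (measure_pmf p) borel (self_info p))"
  by (rule prob_space.real_distribution_distr [OF prob_space_measure_pmf]) simp

lemma cdf_conv_info_cdf: "cdf_conv (info_cdf p) (info_cdf q) = info_cdf (pair_pmf p q)"
proof -
  have "cdf_conv (info_cdf p) (info_cdf q) =
      cdf (distr (measure_pmf (pair_pmf p q)) borel (\<lambda>(x, y). self_info p x + self_info q y))"
    unfolding cdf_conv_def info_cdf_eq_cdf
    by (simp add: interval_measure_cdf real_distribution_self_info convolution_distr_pmf)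
  also have "distr (measure_pmf (pair_pmf p q)) borel (\<lambda>(x, y). self_info p x + self_info q y) =
      distr (measure_pmf (pair_pmf p q)) borel (self_info (pair_pmf p q))"
    \<comment> \<open>On the support both factors are positive and \<open>log_mult\<close> makes
      self information additive; off it the default value may break additivity, so the functions
      agree only almost everywhere.\<close>
    by (rule distr_cong_AE)
       (auto simp: AE_measure_pmf_iff self_info_def pmf_pair log_mult pmf_positive set_pmf_iff)
  finally show ?thesis
    by (simp add: info_cdf_eq_cdf)
qed

lemma cdf_conv_power_info_cdf:
  assumes "n \<ge> 1"
  shows "cdf_conv_power (info_cdf q) n = info_cdf (replicate_pmf n q)"
proof -
  have "(cdf_conv (info_cdf q) ^^ k) (info_cdf q) = info_cdf (replicate_pmf (Suc k) q)" for k
  proof (induction k)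
    case 0
    have "info_cdf (map_pmf (\<lambda>x. [x]) q) = info_cdf q"
      by (rule info_cdf_map_inj) (simp add: inj_on_def)
    then show ?case
      using replicate_pmf_1 [of q] by simp
  next
    case (Suc k)
    then have "(cdf_conv (info_cdf q) ^^ Suc k) (info_cdf q) =
        info_cdf (pair_pmf q (replicate_pmf (Suc k) q))"
      by (simp add: cdf_conv_info_cdf del: replicate_pmf.simps)
    also have "\<dots> = info_cdf (replicate_pmf (Suc (Suc k)) q)"
      unfolding replicate_pmf_Suc_pair [of "Suc k"]
      by (rule info_cdf_map_inj [symmetric]) (auto simp: inj_on_def)
    finally show ?case .
  qed
  \<comment> \<open>There is one convolution fewer than there are letters.\<close>
  from this [of "n - 1"] show ?thesis
    using assms by (simp add: cdf_conv_power_def)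
qed

section \<open>Bounding the exponent\<close>

text \<open>The form in which equality of spectra is exploited: a spectrum determines the total mass
  of the atoms above each positive threshold.\<close>

lemma prob_pmf_ge_eq_info_cdf:
  assumes "c > 0"
  shows "measure_pmf.prob p {x. c \<le> pmf p x} = info_cdf p (- log 2 c)"
  unfolding info_cdf_def
  by (rule measure_pmf.finite_measure_eq_AE)
     (use assms in \<open>auto simp: AE_measure_pmf_iff self_info_def pmf_positive\<close>)

lemma nonconstant_info_cdf_exponent_bound:
  assumes "\<nexists>x. p = return_pmf x"
  shows "\<exists>N. \<forall>n q. info_cdf p = info_cdf (replicate_pmf n q) \<longrightarrow> n \<le> N"
proof -
  obtain x where x: "\<And>z. pmf p z \<le> pmf p x"
    by (rule pmf_has_mode [of p]) (rule that)
  obtain y where y: "y \<in> set_pmf p" "y \<noteq> x"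
    using assms set_pmf_subset_singleton [of p x] by blast
  define c where "c = pmf p y"
  have "c > 0"
    using y by (simp add: c_def pmf_positive)
  have "n \<le> nat \<lceil>1 / c\<rceil>" if eq: "info_cdf p = info_cdf (replicate_pmf n q)" for n q
  proof -
    let ?Q = "replicate_pmf n q"
    have prob_eq: "measure_pmf.prob p {z. d \<le> pmf p z} = measure_pmf.prob ?Q {v. d \<le> pmf ?Q v}"
      if "d > 0" for d
      using that eq by (simp add: prob_pmf_ge_eq_info_cdf)
    obtain a where a: "\<And>z. pmf q z \<le> pmf q a"
      by (rule pmf_has_mode [of q]) (rule that)
    let ?d = "pmf p x + c"
    have "\<exists>v. v \<noteq> replicate n a \<and> c \<le> pmf ?Q v"
    proof (rule ccontr)
      assume "\<not> ?thesis"
      then have "{v. c \<le> pmf ?Q v} \<subseteq> {replicate n a}"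
        by auto
      then have "measure_pmf.prob ?Q {v. c \<le> pmf ?Q v} \<le> pmf ?Q (replicate n a)"
        unfolding measure_pmf_single [symmetric]
        by (rule measure_pmf.finite_measure_mono) simp
      moreover have "?d = measure_pmf.prob p {x, y}"
        using y by (simp add: c_def measure_measure_pmf_finite)
      moreover have "\<dots> \<le> measure_pmf.prob p {z. c \<le> pmf p z}"
        using x by (intro measure_pmf.finite_measure_mono) (auto simp: c_def)
      ultimately have d_le: "?d \<le> pmf ?Q (replicate n a)"
        using prob_eq [OF \<open>c > 0\<close>] by linarith
      have "?d > 0"
        using \<open>c > 0\<close> by (simp add: add_nonneg_pos)
      then have "replicate n a \<in> set_pmf ?Q"
        using d_le unfolding pmf_positive_iff [symmetric] by (rule less_le_trans)
      \<comment> \<open>Equality of spectra is now used at the second threshold \<open>?d\<close>: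
        an atom of this size in \<open>?Q\<close> requires one in \<open>p\<close>, but
        \<open>?d\<close> exceeds the mode of \<open>p\<close>.\<close>
      then have "0 < measure_pmf.prob ?Q {v. ?d \<le> pmf ?Q v}"
        by (rule measure_pmf_posI) (rule CollectI, rule d_le)
      then have "0 < measure_pmf.prob p {z. ?d \<le> pmf p z}"
        unfolding prob_eq [OF \<open>?d > 0\<close>] .
      moreover have "{z. ?d \<le> pmf p z} = {}"
      proof -
        have "pmf p z < ?d" for z
          using x [of z] \<open>c > 0\<close> by linarith
        then show ?thesis
          by (simp add: not_le)
      qed
      ultimately show False
        by (simp only: measure_empty less_irrefl)
    qed
    then obtain v where v: "v \<noteq> replicate n a" "c \<le> pmf ?Q v"
      by blast
    then have "length v = n"
      using \<open>c > 0\<close> by (auto simp: pmf_replicate_pmf split: if_splits)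
    then have "real n * pmf ?Q v \<le> 1"
      by (rule pmf_replicate_pmf_le_of_not_mode [OF a _ v(1)])
    then have "real n * c \<le> 1"
      using mult_left_mono [OF v(2), of "real n"] by linarith
    then have "real n \<le> 1 / c"
      using \<open>c > 0\<close> by (simp add: field_simps)
    then show ?thesis
      by linarith
  qed
  then show ?thesis
    by blast
qed

text \<open>Constants must be set aside: their spectrum is a fixed point of self-convolution, hence
  in every power, and they are infinitely divisible themselves.\<close>

theorem proposition8:
  shows "info_spectra_inf - {info_cdf (return_pmf (0::nat))} = {} \<and>
    \<not> (\<exists>p :: 'a pmf. (\<nexists>x. p = return_pmf x) \<and> info_infinitely_divisible p)"
proof (intro conjI notI)
  have "F = info_cdf (return_pmf (0::nat))" if "F \<in> info_spectra_inf" for F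
  proof -
    have pow: "\<exists>q :: nat pmf. F = info_cdf (replicate_pmf n q)" if "n \<ge> 1" for n
    proof -
      have "F \<in> info_spectra_power n"
        using \<open>F \<in> info_spectra_inf\<close> that by (simp add: info_spectra_inf_def)
      then show ?thesis
        using that by (auto simp: info_spectra_power_def info_spectra_def cdf_conv_power_info_cdf)
    qed
    \<comment> \<open>Any exponent yields such a \<open>p\<close>, which is why it lives on
      words.\<close>
    then obtain p :: "nat list pmf" where p: "F = info_cdf p"
      by blast
    have "\<exists>x. p = return_pmf x"
    proof (rule ccontr)
      assume "\<not> ?thesis"
      from nonconstant_info_cdf_exponent_bound [OF this, where ?'b = nat]
      obtain N where "\<And>n (q :: nat pmf). info_cdf p = info_cdf (replicate_pmf n q) \<Longrightarrow> n \<le> N"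
        by blast
      with pow [of "Suc N"] p show False
        by (metis Suc_n_not_le_n le_add1 plus_1_eq_Suc)
    qed
    then obtain x where "p = return_pmf x" ..
    \<comment> \<open>All point masses share one spectrum, as any map is injective on a
      singleton.\<close>
    then have "p = map_pmf (\<lambda>_. x) (return_pmf (0::nat))"
      by (simp only: map_return_pmf)
    then have "info_cdf p = info_cdf (return_pmf (0::nat))"
      by (simp only:) (rule info_cdf_map_inj, simp)
    then show ?thesis
      by (simp only: p)
  qed
  then show "info_spectra_inf - {info_cdf (return_pmf (0::nat))} = {}"
    by blast
next
  assume "\<exists>p :: 'a pmf. (\<nexists>x. p = return_pmf x) \<and> info_infinitely_divisible p"
  then obtain p :: "'a pmf" where p: "\<nexists>x. p = return_pmf x" and div: "info_infinitely_divisible p"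
    by blast
  from nonconstant_info_cdf_exponent_bound [OF p, where ?'b = nat]
  obtain N where N: "\<And>n (q :: nat pmf). info_cdf p = info_cdf (replicate_pmf n q) \<Longrightarrow> n \<le> N"
    by blast
  obtain q :: "nat pmf" and f where "inj_on f (set_pmf (replicate_pmf (Suc N) q))"
    "p = map_pmf f (replicate_pmf (Suc N) q)"
    using div unfolding info_infinitely_divisible_def by (metis le_add1 plus_1_eq_Suc)
  then have "info_cdf p = info_cdf (replicate_pmf (Suc N) q)"
    using info_cdf_map_inj by blast
  then show False
    using N by fastforce
qed

end
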